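(* For every $n\ge 1$, the quadratic algebra $ch(P_n)$ is Koszul.
   Context: Fix a ground field $F$; $[m]=\{1,\dots,m\}$ and $[x,y]=xy-yx$. $ch(P_n)$ denotes the associative unital $F$-algebra presented by generators $v_1,\dots,v_n,e_{1,2},e_{2,3},\dots,e_{n-1,n}$ and relations: $[v_i,v_j]=0$ for all $i,j\in[n]$; $[e_{i,i+1},e_{j,j+1}]=0$ for $i,j\in[n-1]$, $j>i+1$; $[v_i,e_{j,j+1}]=0$ for $i\in[n]$, $j\in[n-1]$ with $j>i+1$ or $j<i-2$; $[v_i,e_{i+1,i+2}]=0$ for $i\in[n-2]$; $[v_{i+2},e_{i,i+1}]=0$ for $i\in[n-2]$. A quadratic algebra $A=T(V)/(R)$, where $V$ is the span of the generators and $R\subseteq V\otimes V$ is the span of the defining relations, is called Koszul if for every $m$ the collection of $m-1$ subspaces $V^{\otimes (i-1)}\otimes R\otimes V^{\otimes (m-i-1)}$, $1\le i\le m-1$, generates a distributive lattice of subspaces of $V^{\otimes m}$ (under sum and intersection). *)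

theory Defs
  imports Complex_Main "HOL-Library.Poly_Mapping" "HOL-Algebra.QuotRing" "HOL-Algebra.Module"
begin

section \<open>Tensor algebras and quadratic algebras\<close>

text \<open>
  Lists form the free monoid, written additively because the convolution product of
  \<^typ>\<open>'a \<Rightarrow>\<^sub>0 'b\<close> is indexed by an additive monoid. Thus \<^typ>\<open>'a list \<Rightarrow>\<^sub>0 'f\<close> is the free
  associative unital algebra over \<^typ>\<open>'f\<close> on the letters of type \<^typ>\<open>'a\<close>.
\<close>

instantiation list :: (type) monoid_add
begin

definition zero_list :: "'a list" where "zero_list = []"

definition plus_list :: "'a list \<Rightarrow> 'a list \<Rightarrow> 'a list" where "plus_list = (@)"

instance by standard (simp_all add: zero_list_def plus_list_def)

end

definition scale :: "'f::field \<Rightarrow> ('a list \<Rightarrow>\<^sub>0 'f) \<Rightarrow> ('a list \<Rightarrow>\<^sub>0 'f)"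
  where "scale c f = Poly_Mapping.single 0 c * f"

interpretation FA: vector_space scale
  by standard
    (simp_all add: scale_def algebra_simps single_add mult_single flip: mult.assoc)

definition commutator :: "'r::ring \<Rightarrow> 'r \<Rightarrow> 'r"
  where "commutator x y = x * y - y * x"

text \<open>\<open>T(V)\<close> for the vector space \<open>V\<close> with basis \<open>X\<close>.\<close>

definition tensor_algebra :: "'a set \<Rightarrow> ('f::field, 'a list \<Rightarrow>\<^sub>0 'f) module"
  where "tensor_algebra X =
    \<lparr>carrier = {f. \<forall>w \<in> Poly_Mapping.keys f. set w \<subseteq> X}, mult = (*), one = 1,
     zero = 0, add = (+), smult = scale\<rparr>"

text \<open>Hence \<^const>\<open>genideal\<close> below is the two-sided ideal generated by a subset of \<open>T(V)\<close>.\<close>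

lemma ring_tensor_algebra: "ring (tensor_algebra X :: ('f::field, 'a list \<Rightarrow>\<^sub>0 'f) module)"
proof (rule ringI)
  show "abelian_group (tensor_algebra X :: ('f, 'a list \<Rightarrow>\<^sub>0 'f) module)"
  proof (rule abelian_groupI)
    fix f :: "'a list \<Rightarrow>\<^sub>0 'f"
    assume "f \<in> carrier (tensor_algebra X)"
    then show "\<exists>g \<in> carrier (tensor_algebra X).
        g \<oplus>\<^bsub>tensor_algebra X\<^esub> f = \<zero>\<^bsub>tensor_algebra X\<^esub>"
      by (intro bexI[of _ "- f"]) (auto simp: tensor_algebra_def)
  qed (use keys_add in \<open>fastforce simp: tensor_algebra_def algebra_simps\<close>)+
  show "monoid (tensor_algebra X :: ('f, 'a list \<Rightarrow>\<^sub>0 'f) module)"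
  proof (rule monoidI)
    fix f g :: "'a list \<Rightarrow>\<^sub>0 'f"
    assume "f \<in> carrier (tensor_algebra X)" "g \<in> carrier (tensor_algebra X)"
    then show "f \<otimes>\<^bsub>tensor_algebra X\<^esub> g \<in> carrier (tensor_algebra X)"
      using keys_mult[of f g] by (fastforce simp: tensor_algebra_def plus_list_def)
  qed (auto simp: tensor_algebra_def zero_list_def mult.assoc)
qed (auto simp: tensor_algebra_def algebra_simps)

definition factor_algebra ::
    "('f, 'a) module \<Rightarrow> 'a set \<Rightarrow> ('f, 'a set) module"
  where "factor_algebra A I =
    \<lparr>carrier = a_rcosets\<^bsub>A\<^esub> I, mult = rcoset_mult A I, one = I +>\<^bsub>A\<^esub> \<one>\<^bsub>A\<^esub>,
     zero = I, add = set_add A, smult = (\<lambda>c C. \<Union>x\<in>C. I +>\<^bsub>A\<^esub> (c \<odot>\<^bsub>A\<^esub> x))\<rparr>"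

definition presented_algebra ::
    "'a set \<Rightarrow> ('a list \<Rightarrow>\<^sub>0 'f::field) set \<Rightarrow> ('f, ('a list \<Rightarrow>\<^sub>0 'f) set) module"
  where "presented_algebra X S = factor_algebra (tensor_algebra X) (Idl\<^bsub>tensor_algebra X\<^esub> S)"

definition tensor_power :: "'a set \<Rightarrow> nat \<Rightarrow> ('a list \<Rightarrow>\<^sub>0 'f::field) set"
  where "tensor_power X m = {f. \<forall>w \<in> Poly_Mapping.keys f. length w = m \<and> set w \<subseteq> X}"

text \<open>
  \<open>V\<^sup>\<otimes>\<^sup>p \<otimes> R \<otimes> V\<^sup>\<otimes>\<^sup>q\<close> as a subspace of \<open>V\<^sup>\<otimes>\<^sup>m\<close>, \<open>m = p + 2 + q\<close>, for \<open>R \<subseteq> V \<otimes> V\<close>: the tensor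
  product of homogeneous elements of \<open>T(V)\<close> is their product in \<open>T(V)\<close>.
\<close>

definition rel_subspace ::
    "'a set \<Rightarrow> ('a list \<Rightarrow>\<^sub>0 'f::field) set \<Rightarrow> nat \<Rightarrow> nat \<Rightarrow> ('a list \<Rightarrow>\<^sub>0 'f) set"
  where "rel_subspace X R p q =
    FA.span {a * r * b | a r b. a \<in> tensor_power X p \<and> r \<in> R \<and> b \<in> tensor_power X q}"

definition rel_subspaces ::
    "'a set \<Rightarrow> ('a list \<Rightarrow>\<^sub>0 'f::field) set \<Rightarrow> nat \<Rightarrow> ('a list \<Rightarrow>\<^sub>0 'f) set set"
  where "rel_subspaces X R m = {rel_subspace X R (i - 1) (m - i - 1) | i. 1 \<le> i \<and> i \<le> m - 1}"

definition subspace_sum :: "'v::ab_group_add set \<Rightarrow> 'v set \<Rightarrow> 'v set"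
  where "subspace_sum U W = {u + w | u w. u \<in> U \<and> w \<in> W}"

inductive_set generated_lattice :: "'v::ab_group_add set set \<Rightarrow> 'v set set"
  for \<C> :: "'v set set"
  where
    generator: "U \<in> \<C> \<Longrightarrow> U \<in> generated_lattice \<C>"
  | sum: "U \<in> generated_lattice \<C> \<Longrightarrow> W \<in> generated_lattice \<C> \<Longrightarrow>
      subspace_sum U W \<in> generated_lattice \<C>"
  | inter: "U \<in> generated_lattice \<C> \<Longrightarrow> W \<in> generated_lattice \<C> \<Longrightarrow>
      U \<inter> W \<in> generated_lattice \<C>"

text \<open>In any lattice this distributive law implies the dual one.\<close>

definition generates_distributive_lattice :: "'v::ab_group_add set set \<Rightarrow> bool"
  where "generates_distributive_lattice \<C> \<longleftrightarrow>
    (\<forall>U \<in> generated_lattice \<C>. \<forall>W \<in> generated_lattice \<C>. \<forall>Z \<in> generated_lattice \<C>.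
      U \<inter> subspace_sum W Z = subspace_sum (U \<inter> W) (U \<inter> Z))"

text \<open>
  \<open>A\<close> is literally the quotient \<open>T(V)/(R)\<close>, so it determines the data \<open>X\<close> and \<open>R\<close>: its zero is the
  ideal \<open>(R)\<close>, whose degree 2 part is \<open>R\<close>, and the union of its carrier is \<open>T(V)\<close>.
\<close>

definition koszul :: "('f::field, ('a list \<Rightarrow>\<^sub>0 'f) set) module \<Rightarrow> bool"
  where "koszul A \<longleftrightarrow>
    (\<exists>X R. FA.subspace R \<and> R \<subseteq> tensor_power X 2 \<and> A = presented_algebra X R \<and>
      (\<forall>m. generates_distributive_lattice (rel_subspaces X R m)))"

section \<open>The algebra \<open>ch(P\<^sub>n)\<close>\<close>

datatype letter = Vertex nat | Edge nat nat

definition vgen :: "nat \<Rightarrow> (letter list \<Rightarrow>\<^sub>0 'f::field)"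
  where "vgen i = Poly_Mapping.single [Vertex i] 1"

definition egen :: "nat \<Rightarrow> nat \<Rightarrow> (letter list \<Rightarrow>\<^sub>0 'f::field)"
  where "egen i j = Poly_Mapping.single [Edge i j] 1"

definition path_letters :: "nat \<Rightarrow> letter set"
  where "path_letters n = {Vertex i | i. i \<in> {1..n}} \<union> {Edge i (i + 1) | i. i \<in> {1..n - 1}}"

definition path_relations :: "nat \<Rightarrow> (letter list \<Rightarrow>\<^sub>0 'f::field) set"
  where "path_relations n =
    {commutator (vgen i) (vgen j) | i j. i \<in> {1..n} \<and> j \<in> {1..n}} \<union>
    {commutator (egen i (i + 1)) (egen j (j + 1)) | i j.
       i \<in> {1..n - 1} \<and> j \<in> {1..n - 1} \<and> j > i + 1} \<union>
    {commutator (vgen i) (egen j (j + 1)) | i j.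
       i \<in> {1..n} \<and> j \<in> {1..n - 1} \<and> (j > i + 1 \<or> j + 2 < i)} \<union>
    {commutator (vgen i) (egen (i + 1) (i + 2)) | i. i \<in> {1..n - 2}} \<union>
    {commutator (vgen (i + 2)) (egen i (i + 1)) | i. i \<in> {1..n - 2}}"

definition ch_path :: "nat \<Rightarrow> ('f::field, (letter list \<Rightarrow>\<^sub>0 'f) set) module"
  where "ch_path n = presented_algebra (path_letters n) (path_relations n)"

end

theory Submission
  imports Defs "HOL-Combinatorics.Permutations"
begin

text \<open>
  Give \<open>v\<^sub>i\<close> the interval \<open>[i, i]\<close> and \<open>e\<^sub>i\<^sub>,\<^sub>i\<^sub>+\<^sub>1\<close> the interval \<open>[i, i + 1]\<close>: two distinct generators
  commute by a defining relation iff their intervals are disjoint, that is, iff one lies wholly to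
  the left of the other. So the interval order is a transitive orientation of the commutation
  graph. For a word \<open>w\<close> call \<open>i\<close> a descent if \<open>w\<^sub>i\<close> lies to the right of \<open>w\<^sub>i\<^sub>+\<^sub>1\<close>. By transitivity the
  letters in a maximal run of descents commute pairwise; let \<open>b\<^sub>w\<close> be the result of antisymmetrizing
  every such run of \<open>w\<close>. All words of \<open>b\<^sub>w\<close> other than \<open>w\<close> are lexicographically smaller than \<open>w\<close>,
  so the \<open>b\<^sub>w\<close> form a basis, and the subspace with \<open>R\<close> at place \<open>i\<close> is spanned by those \<open>b\<^sub>w\<close> for
  which \<open>i\<close> is a descent of \<open>w\<close>. Subspaces spanned by parts of one basis generate a distributive
  lattice.
\<close>

section \<open>Subspaces spanned by parts of a basis\<close>

text \<open>By uniqueness of coordinates, the expansions of \<open>x\<close> in \<open>S\<close>, in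
  \<open>T\<close> and in \<open>B\<close> coincide, so only vectors of \<open>S \<inter> T\<close>
  get a nonzero coefficient.\<close>

lemma (in vector_space) span_Int_independent:
  assumes B: "independent B" and "S \<subseteq> B" "T \<subseteq> B"
  shows "span S \<inter> span T = span (S \<inter> T)"
proof
  show "span S \<inter> span T \<subseteq> span (S \<inter> T)"
  proof
    fix x assume x: "x \<in> span S \<inter> span T"
    have *: "representation B x = representation S x" "representation B x = representation T x"
      using representation_extend[OF B] x assms by auto
    have "b \<in> S \<inter> T" if "representation B x b \<noteq> 0" for b
      using that representation_ne_zero[of S x b] representation_ne_zero[of T x b] * by auto
    then have "(\<Sum>b | representation B x b \<noteq> 0. scale (representation B x b) b) \<in> span (S \<inter> T)"
      by (intro span_sum span_scale span_base) auto
    moreover have "x \<in> span B"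
      using x span_mono[OF \<open>S \<subseteq> B\<close>] by auto
    ultimately show "x \<in> span (S \<inter> T)"
      using sum_nonzero_representation_eq[OF B] by simp
  qed
qed (simp add: span_mono)

text \<open>On subsets of \<open>B\<close>, \<open>span\<close> turns unions into sums and, by
  independence, intersections into intersections. Every member of the lattice is therefore the span
  of a part of \<open>B\<close>, and distributivity is inherited from sets.\<close>

lemma (in vector_space) generates_distributive_lattice_if_independent:
  assumes B: "independent B" and \<C>: "\<And>U. U \<in> \<C> \<Longrightarrow> \<exists>S \<subseteq> B. U = span S"
  shows "generates_distributive_lattice \<C>"
proof -
  have sum_span: "subspace_sum (span S) (span T) = span (S \<union> T)" for S T
    by (auto simp: subspace_sum_def span_Un)
  have span: "\<exists>S \<subseteq> B. U = span S" if "U \<in> generated_lattice \<C>" for U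
    using that
  proof induction
    case (sum U W)
    then obtain S T where "S \<subseteq> B" "U = span S" "T \<subseteq> B" "W = span T" by blast
    then show ?case by (intro exI[of _ "S \<union> T"]) (simp add: sum_span)
  next
    case (inter U W)
    then obtain S T where "S \<subseteq> B" "U = span S" "T \<subseteq> B" "W = span T" by blast
    then show ?case
      by (intro exI[of _ "S \<inter> T"]) (auto simp: span_Int_independent[OF B])
  qed (rule \<C>)
  show ?thesis
    unfolding generates_distributive_lattice_def
  proof (intro ballI)
    fix U W Z
    assume "U \<in> generated_lattice \<C>" "W \<in> generated_lattice \<C>" "Z \<in> generated_lattice \<C>"
    then obtain S T Q where *: "S \<subseteq> B" "T \<subseteq> B" "Q \<subseteq> B" "U = span S" "W = span T" "Z = span Q"
      using span by meson
    then have "T \<union> Q \<subseteq> B" by simp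
    then show "U \<inter> subspace_sum W Z = subspace_sum (U \<inter> W) (U \<inter> Z)"
      by (simp add: * sum_span span_Int_independent[OF B] Int_Un_distrib)
  qed
qed

section \<open>The free algebra\<close>

lemma sum_single_keys: "(\<Sum>w \<in> Poly_Mapping.keys f. Poly_Mapping.single w (Poly_Mapping.lookup f w)) = f"
  by (rule poly_mapping_eqI) (auto simp: lookup_sum lookup_single when_def in_keys_iff)

lemma poly_mapping_induct [case_names zero single sum]:
  fixes f :: "'a \<Rightarrow>\<^sub>0 'b::comm_monoid_add"
  assumes "P 0" and "\<And>k v. P (Poly_Mapping.single k v)" and "\<And>f g. P f \<Longrightarrow> P g \<Longrightarrow> P (f + g)"
  shows "P f"
proof -
  have "P (\<Sum>w \<in> A. Poly_Mapping.single w (Poly_Mapping.lookup f w))" for A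
    by (induction A rule: infinite_finite_induct) (simp_all add: assms)
  from this[of "Poly_Mapping.keys f"] show ?thesis
    by (simp only: sum_single_keys)
qed

lemma lookup_scale [simp]: "Poly_Mapping.lookup (scale c f) w = c * Poly_Mapping.lookup f w"
proof (induction f rule: poly_mapping_induct)
  case zero
  then show ?case by (simp add: scale_def)
next
  case (single k v)
  then show ?case
    by (simp add: scale_def mult_single zero_list_def plus_list_def lookup_single when_def)
next
  case (sum f g)
  then show ?case
    by (simp add: scale_def algebra_simps lookup_add)
qed

lemma scale_single [simp]: "scale c (Poly_Mapping.single w d) = Poly_Mapping.single w (c * d)"
  by (rule poly_mapping_eqI) (simp add: lookup_single when_def)

lemma mult_single_words [simp]:
  "Poly_Mapping.single u c * Poly_Mapping.single v d = Poly_Mapping.single (u @ v) (c * d :: 'f::field)"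
  by (simp add: mult_single plus_list_def)

lemma scale_mult_left: "scale c x * y = scale c (x * y)"
  by (simp add: scale_def mult.assoc)

lemma scale_mult_right: "x * scale c y = scale c (x * y)"
proof -
  \<comment> \<open>\<open>scale\<close> multiplies by a constant from the left; constants sit on
    the empty word and are central.\<close>
  have "x * Poly_Mapping.single 0 c = scale c x"
    by (induction x rule: poly_mapping_induct)
      (simp_all add: algebra_simps FA.scale_right_distrib zero_list_def)
  then show ?thesis
    by (simp flip: mult.assoc add: scale_def)
qed

text \<open>Bilinearity of the product. It reduces the outer factors in \<open>rel_subspace\<close>
  to words and the middle one to a single commutator.\<close>

lemma span_mult:
  assumes "x \<in> FA.span A" "y \<in> FA.span B"
  shows "x * y \<in> FA.span {a * b | a b. a \<in> A \<and> b \<in> B}"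
  using assms(1)
proof (induction rule: FA.span_induct_alt)
  case (step c a z)
  have "a * y \<in> FA.span {a * b | a b. a \<in> A \<and> b \<in> B}"
    using assms(2)
  proof (induction rule: FA.span_induct_alt)
    case (step d b z)
    have "a * b \<in> FA.span {a * b | a b. a \<in> A \<and> b \<in> B}"
      using \<open>a \<in> A\<close> \<open>b \<in> B\<close> by (intro FA.span_base) auto
    then show ?case
      using step.IH by (simp add: distrib_left scale_mult_right FA.span_add FA.span_scale)
  qed (simp add: FA.span_zero)
  then show ?case
    using step.IH by (simp add: distrib_right scale_mult_left FA.span_add FA.span_scale)
qed (simp add: FA.span_zero)

lemma tensor_power_subset_span:
  "tensor_power X m \<subseteq> FA.span {Poly_Mapping.single w 1 | w. length w = m \<and> set w \<subseteq> X}"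
proof
  fix f :: "'a list \<Rightarrow>\<^sub>0 'f::field" assume f: "f \<in> tensor_power X m"
  have "f = (\<Sum>w \<in> Poly_Mapping.keys f. scale (Poly_Mapping.lookup f w) (Poly_Mapping.single w 1))"
    by (simp add: sum_single_keys)
  also have "\<dots> \<in> FA.span {Poly_Mapping.single w 1 | w. length w = m \<and> set w \<subseteq> X}"
    using f by (intro FA.span_sum FA.span_scale FA.span_base) (auto simp: tensor_power_def)
  finally show "f \<in> FA.span {Poly_Mapping.single w 1 | w. length w = m \<and> set w \<subseteq> X}" .
qed

lemma subspace_tensor_power: "FA.subspace (tensor_power X m :: ('a list \<Rightarrow>\<^sub>0 'f::field) set)"
  unfolding FA.subspace_def
proof (intro conjI ballI allI)
  fix f g :: "'a list \<Rightarrow>\<^sub>0 'f"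
  assume "f \<in> tensor_power X m" "g \<in> tensor_power X m"
  then show "f + g \<in> tensor_power X m"
    using keys_add[of f g] by (auto simp: tensor_power_def)
next
  fix c and f :: "'a list \<Rightarrow>\<^sub>0 'f"
  assume "f \<in> tensor_power X m"
  then show "scale c f \<in> tensor_power X m"
    by (auto simp: tensor_power_def in_keys_iff)
qed (simp add: tensor_power_def)

text \<open>Among the finitely many words with nonzero coefficient in a vanishing combination,
  acyclicity gives a maximal one, \<open>m\<close>. It occurs in no other contributing
  \<open>b w\<close>, so comparing coefficients at \<open>m\<close> forces its own coefficient to be
  zero.\<close>

lemma independent_unitriangular:
  fixes b :: "'a list \<Rightarrow> ('a list \<Rightarrow>\<^sub>0 'f::field)"
  assumes "acyclic r"
    and diag: "\<And>w. w \<in> W \<Longrightarrow> Poly_Mapping.lookup (b w) w = 1"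
    and lower: "\<And>u w. w \<in> W \<Longrightarrow> u \<noteq> w \<Longrightarrow> Poly_Mapping.lookup (b w) u \<noteq> 0 \<Longrightarrow> (u, w) \<in> r"
  shows "FA.independent (b ` W)"
proof -
  have *: "c (b w) = 0" if T: "finite T" "T \<subseteq> W" and 0: "(\<Sum>w\<in>T. scale (c (b w)) (b w)) = 0" and "w \<in> T" for T c w
  proof (rule ccontr)
    assume "c (b w) \<noteq> 0"
    define S where "S = {w \<in> T. c (b w) \<noteq> 0}"
    have "finite S" "S \<noteq> {}"
      using T \<open>w \<in> T\<close> \<open>c (b w) \<noteq> 0\<close> by (auto simp: S_def)
    moreover have "wf (converse (Restr r S))"
      using \<open>finite S\<close> \<open>acyclic r\<close> by (intro finite_acyclic_wf_converse) (auto intro: acyclic_subset)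
    ultimately obtain m where m: "m \<in> S" "\<And>u. (m, u) \<in> Restr r S \<Longrightarrow> u \<notin> S"
      by (metis converseI wfE_min ex_in_conv)
    have "0 = (\<Sum>w\<in>T. c (b w) * Poly_Mapping.lookup (b w) m)"
      using arg_cong[OF 0, of "\<lambda>f. Poly_Mapping.lookup f m"] by (simp add: lookup_sum)
    also have "\<dots> = (\<Sum>w\<in>T. if w = m then c (b m) else 0)"
    proof (rule sum.cong)
      fix w assume "w \<in> T"
      show "c (b w) * Poly_Mapping.lookup (b w) m = (if w = m then c (b m) else 0)"
        using \<open>w \<in> T\<close> T m diag[of w] lower[of w m] by (auto simp: S_def)
    qed simp
    also have "\<dots> = c (b m)"
      using T m by (simp add: S_def)
    finally show False
      using m by (simp add: S_def)
  qed
  show ?thesis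
    unfolding FA.independent_explicit_module
  proof (intro allI impI)
    fix t c v
    assume t: "finite t" "t \<subseteq> b ` W" "(\<Sum>v\<in>t. scale (c v) v) = 0" "v \<in> t"
    \<comment> \<open>One word is chosen for each vector of \<open>t\<close>, which turns the sum
      over vectors into a sum over words.\<close>
    then obtain T where T: "T \<subseteq> W" "inj_on b T" "t = b ` T"
      by (meson subset_image_inj)
    then show "c v = 0"
      using t *[of T c] by (auto simp: sum.reindex finite_image_iff)
  qed
qed

section \<open>Transitively oriented commutation relations\<close>

text \<open>Written with \<open>permute_list\<close> so that the swap composes with permutations of
  the places of a word.\<close>

definition swap_diff :: "nat \<Rightarrow> 'a list \<Rightarrow> ('a list \<Rightarrow>\<^sub>0 'f::field)"
  where "swap_diff i w =
    Poly_Mapping.single w 1 - Poly_Mapping.single (permute_list (transpose i (Suc i)) w) 1"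

lemma transpose_permutes_lessThan: "Suc i < m \<Longrightarrow> transpose i (Suc i) permutes {..<m}"
  by (rule permutes_swap_id) auto

lemma swap_diff_append:
  "swap_diff (length u) (u @ [x, y] @ v) =
    Poly_Mapping.single (u @ [x, y] @ v) 1 - Poly_Mapping.single (u @ [y, x] @ v) (1 :: 'f::field)"
proof -
  have "permute_list (transpose (length u) (Suc (length u))) (u @ [x, y] @ v) = u @ [y, x] @ v"
  proof (rule nth_equalityI)
    fix k assume "k < length (permute_list (transpose (length u) (Suc (length u))) (u @ [x, y] @ v))"
    then have "permute_list (transpose (length u) (Suc (length u))) (u @ [x, y] @ v) ! k =
        (u @ [x, y] @ v) ! transpose (length u) (Suc (length u)) k"
      by (intro permute_list_nth transpose_permutes_lessThan) simp_all
    also have "\<dots> = (u @ [y, x] @ v) ! k"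
      by (cases "k < length u"; cases "k = length u"; cases "k = Suc (length u)")
        (auto simp: transpose_def nth_append nth_Cons split: nat.split)
    finally show "permute_list (transpose (length u) (Suc (length u))) (u @ [x, y] @ v) ! k =
        (u @ [y, x] @ v) ! k" .
  qed simp
  then show ?thesis
    by (simp add: swap_diff_def)
qed

text \<open>\<open>(y, x) \<in> r\<close> means that \<open>x\<close> and \<open>y\<close> commute and that \<open>x y\<close> has a descent.\<close>

locale transitive_commutation =
  fixes X :: "'a set" and r :: "'a rel"
  assumes letters: "r \<subseteq> X \<times> X" and trans: "trans r" and wf: "wf r"
begin

definition commutators :: "('a list \<Rightarrow>\<^sub>0 'f::field) set"
  where "commutators =
    {Poly_Mapping.single [x, y] 1 - Poly_Mapping.single [y, x] 1 | x y. (y, x) \<in> r}"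

definition words :: "nat \<Rightarrow> 'a list set"
  where "words m = {w. length w = m \<and> set w \<subseteq> X}"

definition descents :: "'a list \<Rightarrow> nat set"
  where "descents w = {i. Suc i < length w \<and> (w ! Suc i, w ! i) \<in> r}"

text \<open>By bilinearity the space is spanned by products of a word \<open>u\<close>, a commutator
  of letters \<open>x\<close>, \<open>y\<close> and a word \<open>v\<close>. Such a product is
  \<open>swap_diff p\<close> of the word \<open>u @ [x, y] @ v\<close>, whose place
  \<open>p = length u\<close> (counted from 0) is a descent.\<close>

lemma rel_subspace_commutators:
  "rel_subspace X (FA.span commutators :: ('a list \<Rightarrow>\<^sub>0 'f::field) set) p q =
    FA.span (swap_diff p ` {w \<in> words (p + 2 + q). p \<in> descents w})" (is "?L = FA.span ?E")
proof
  have "?L \<subseteq> FA.span {a * b | a b. a \<in> {a * b | a b.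
      a \<in> {Poly_Mapping.single w 1 | w. length w = p \<and> set w \<subseteq> X} \<and> b \<in> commutators} \<and>
      b \<in> {Poly_Mapping.single w 1 | w. length w = q \<and> set w \<subseteq> X}}"
    unfolding rel_subspace_def
    using tensor_power_subset_span[of X p, where 'b = 'f] tensor_power_subset_span[of X q, where 'b = 'f]
    by (intro FA.span_minimal FA.subspace_span subsetI) (blast intro: span_mult)
  also have "\<dots> \<subseteq> FA.span ?E"
  proof (rule FA.span_mono, clarify)
    fix u v c assume *: "set u \<subseteq> X" "set v \<subseteq> X" "p = length u" "q = length v"
      and "(c :: 'a list \<Rightarrow>\<^sub>0 'f) \<in> commutators"
    then obtain x y where "(y, x) \<in> r"
      and c: "c = Poly_Mapping.single [x, y] 1 - Poly_Mapping.single [y, x] 1"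
      by (auto simp: commutators_def)
    have "Poly_Mapping.single u 1 * c * Poly_Mapping.single v 1 =
        swap_diff (length u) (u @ [x, y] @ v)"
      unfolding swap_diff_append c by (simp add: left_diff_distrib right_diff_distrib)
    moreover have "u @ [x, y] @ v \<in> {w \<in> words (length u + 2 + length v). length u \<in> descents w}"
      using * letters \<open>(y, x) \<in> r\<close> by (auto simp: words_def descents_def nth_append)
    ultimately show "Poly_Mapping.single u 1 * c * Poly_Mapping.single v 1 \<in>
        swap_diff (length u) ` {w \<in> words (length u + 2 + length v). length u \<in> descents w}"
      by blast
  qed
  finally show "?L \<subseteq> FA.span ?E" .
  have "swap_diff p w \<in> ?L" if w: "w \<in> words (p + 2 + q)" "p \<in> descents w" for w
  proof -
    define u v x y where "u = take p w" and "v = drop (p + 2) w" and "x = w ! p" and "y = w ! Suc p"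
    have p: "Suc p < length w"
      using w by (simp add: words_def)
    then have w_eq: "w = u @ [x, y] @ v"
      using id_take_nth_drop[of p w] Cons_nth_drop_Suc[OF p]
      by (simp add: u_def v_def x_def y_def)
    have len: "length u = p" "length v = q" and X: "set u \<subseteq> X" "set v \<subseteq> X"
      using w p by (auto simp: words_def u_def v_def dest: in_set_takeD in_set_dropD)
    have "swap_diff p w =
        Poly_Mapping.single (u @ [x, y] @ v) 1 - Poly_Mapping.single (u @ [y, x] @ v) (1::'f)"
      using swap_diff_append[of u x y v, where 'f = 'f] by (simp only: len(1) flip: w_eq)
    also have "\<dots> = Poly_Mapping.single u 1 *
        (Poly_Mapping.single [x, y] 1 - Poly_Mapping.single [y, x] 1) * Poly_Mapping.single v 1"
      by (simp add: left_diff_distrib right_diff_distrib)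
    finally have "swap_diff p w = Poly_Mapping.single u 1 *
        (Poly_Mapping.single [x, y] 1 - Poly_Mapping.single [y, x] (1::'f)) * Poly_Mapping.single v 1" .
    moreover have "Poly_Mapping.single [x, y] 1 - Poly_Mapping.single [y, x] (1::'f) \<in> FA.span commutators"
      using w by (intro FA.span_base) (auto simp: commutators_def descents_def x_def y_def)
    moreover have "Poly_Mapping.single u (1::'f) \<in> tensor_power X p" "Poly_Mapping.single v (1::'f) \<in> tensor_power X q"
      using len X by (simp_all add: tensor_power_def)
    ultimately show ?thesis
      unfolding rel_subspace_def by (intro FA.span_base) blast
  qed
  then show "FA.span ?E \<subseteq> ?L"
    unfolding rel_subspace_def by (intro FA.span_minimal FA.subspace_span image_subsetI) blast
qed

text \<open>Two places of \<open>w\<close> have the same index iff they lie in the same maximal run of descents.\<close>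

definition run_index :: "'a list \<Rightarrow> nat \<Rightarrow> nat"
  where "run_index w p = card ({..<p} - descents w)"

text \<open>The Young subgroup of the symmetric group on the places of \<open>w\<close> that
  preserves every maximal run of descents.\<close>

definition run_perms :: "'a list \<Rightarrow> (nat \<Rightarrow> nat) set"
  where "run_perms w =
    {\<pi>. \<pi> permutes {..<length w} \<and> (\<forall>p. run_index w (\<pi> p) = run_index w p)}"

definition alternating :: "'a list \<Rightarrow> ('a list \<Rightarrow>\<^sub>0 'f::field)"
  where "alternating w = (\<Sum>\<pi>\<in>run_perms w. Poly_Mapping.single (permute_list \<pi> w) (of_int (sign \<pi>)))"

lemma finite_run_perms: "finite (run_perms w)"
  by (rule finite_subset[OF _ finite_permutations[of "{..<length w}"]]) (auto simp: run_perms_def)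

lemma id_in_run_perms: "id \<in> run_perms w"
  by (simp add: run_perms_def permutes_id)

lemma transpose_in_run_perms:
  assumes "i \<in> descents w"
  shows "transpose i (Suc i) \<in> run_perms w"
proof -
  have "run_index w (Suc i) = run_index w i"
    using assms by (auto simp: run_index_def lessThan_Suc)
  then show ?thesis
    using assms transpose_permutes_lessThan[of i "length w"]
    by (simp add: run_perms_def descents_def) (simp add: transpose_def)
qed

lemma run_perms_comp: "\<pi> \<in> run_perms w \<Longrightarrow> \<rho> \<in> run_perms w \<Longrightarrow> \<pi> \<circ> \<rho> \<in> run_perms w"
  by (auto simp: run_perms_def intro: permutes_compose)

section \<open>Run permutations lower a word lexicographically\<close>

text \<open>Equal run indices leave no non-descent between \<open>p\<close> and \<open>q\<close>,
  since nested finite sets of equal size are equal. The descents at consecutive places then chain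
  together by transitivity of \<open>r\<close>.\<close>

lemma less_if_run_index_eq:
  assumes "p < q" "q < length w" "run_index w p = run_index w q"
  shows "(w ! q, w ! p) \<in> r"
proof -
  have "{..<p} - descents w = {..<q} - descents w"
    using assms by (intro card_subset_eq) (auto simp: run_index_def)
  then have desc: "i \<in> descents w" if "p \<le> i" "i < q" for i
    using that by (metis DiffD1 DiffI lessThan_iff not_less)
  have "p < q' \<Longrightarrow> q' \<le> q \<Longrightarrow> (w ! q', w ! p) \<in> r" for q'
  proof (induction q')
    case (Suc q')
    then have "(w ! Suc q', w ! q') \<in> r"
      using desc[of q'] by (simp add: descents_def)
    then show ?case
      using Suc trans by (cases "p = q'") (auto dest: transD)
  qed simp
  then show ?thesis
    using assms by simp
qed

lemma run_perms_nth:
  assumes "\<pi> \<in> run_perms w" "p < length w"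
  shows "permute_list \<pi> w ! p = w ! \<pi> p" "\<pi> p < length w"
  using assms permutes_in_image[of \<pi> "{..<length w}" p]
  by (auto simp: run_perms_def permute_list_nth)

text \<open>At the first moved place \<open>p\<close>, injectivity gives \<open>\<pi> p > p\<close>
  because all earlier places are fixed. So \<open>p\<close> receives a letter from later in its run,
  which is smaller with respect to \<open>r\<close>. The order \<open>lex r\<close> compares only
  words of equal length, hence is well-founded.\<close>

lemma permute_list_less:
  assumes \<pi>: "\<pi> \<in> run_perms w" and "\<pi> \<noteq> id"
  shows "(permute_list \<pi> w, w) \<in> lex r"
proof -
  define p where "p = (LEAST p. \<pi> p \<noteq> p)"
  have "\<exists>p. \<pi> p \<noteq> p"
    using \<open>\<pi> \<noteq> id\<close> by (auto simp: fun_eq_iff)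
  then have p: "\<pi> p \<noteq> p"
    unfolding p_def by (rule LeastI_ex)
  have fixed: "\<pi> k = k" if "k < p" for k
    using that not_less_Least unfolding p_def by blast
  have perm: "\<pi> permutes {..<length w}"
    using \<pi> by (simp add: run_perms_def)
  then have "p < length w"
    using p by (auto simp: permutes_def)
  have "\<not> \<pi> p < p"
    using fixed[of "\<pi> p"] p permutes_inj[OF perm] by (auto dest: injD)
  then have "(w ! \<pi> p, w ! p) \<in> r"
    using p run_perms_nth[OF \<pi> \<open>p < length w\<close>] \<pi>
    by (intro less_if_run_index_eq) (auto simp: run_perms_def)
  moreover have "take p (permute_list \<pi> w) = take p w"
    using fixed \<open>p < length w\<close> by (intro nth_equalityI) (simp_all add: run_perms_nth[OF \<pi>])
  ultimately show ?thesis
    using \<open>p < length w\<close> run_perms_nth[OF \<pi> \<open>p < length w\<close>]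
    by (auto simp: lexord_lex lexord_take_index_conv)
qed

lemma lookup_alternating:
  "Poly_Mapping.lookup (alternating w :: 'a list \<Rightarrow>\<^sub>0 'f::field) u =
    (\<Sum>\<pi>\<in>run_perms w. if permute_list \<pi> w = u then of_int (sign \<pi>) else 0)"
  by (simp add: alternating_def lookup_sum lookup_single when_def)

text \<open>Only the identity contributes, as every other run permutation strictly lowers
  \<open>w\<close>. No factorial appears, so the coefficient is 1 in every characteristic.\<close>

lemma lookup_alternating_diag: "Poly_Mapping.lookup (alternating w :: 'a list \<Rightarrow>\<^sub>0 'f::field) w = 1"
proof -
  have "permute_list \<pi> w \<noteq> w" if "\<pi> \<in> run_perms w" "\<pi> \<noteq> id" for \<pi>
    using permute_list_less[OF that] wf_not_refl[OF wf_lex[OF wf]] by metis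
  then have "Poly_Mapping.lookup (alternating w) w = (\<Sum>\<pi>\<in>run_perms w. if \<pi> = id then 1 else 0 :: 'f)"
    unfolding lookup_alternating by (intro sum.cong) auto
  then show ?thesis
    by (simp add: finite_run_perms id_in_run_perms)
qed

lemma lookup_alternating_lower:
  assumes "Poly_Mapping.lookup (alternating w :: 'a list \<Rightarrow>\<^sub>0 'f::field) u \<noteq> 0" "u \<noteq> w"
  shows "(u, w) \<in> lex r"
proof -
  obtain \<pi> where \<pi>: "\<pi> \<in> run_perms w" "(if permute_list \<pi> w = u then of_int (sign \<pi>) else 0 :: 'f) \<noteq> 0"
    using assms(1) unfolding lookup_alternating by (rule sum.not_neutral_contains_not_neutral)
  then have u: "permute_list \<pi> w = u"
    by meson
  then have "\<pi> \<noteq> id"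
    using \<open>u \<noteq> w\<close> by auto
  then show ?thesis
    using permute_list_less[of \<pi> w] \<pi> u by simp
qed

lemma independent_alternating: "FA.independent (alternating ` W :: ('a list \<Rightarrow>\<^sub>0 'f::field) set)"
  using wf_acyclic[OF wf_lex[OF wf]] lookup_alternating_diag lookup_alternating_lower
  by (intro independent_unitriangular) auto

section \<open>Alternating elements span the relation subspaces\<close>

text \<open>Run permutations are paired as \<open>\<pi>\<close> and
  \<open>\<pi> \<circ> \<tau>\<close>, where \<open>\<tau>\<close> swaps \<open>i\<close> and
  \<open>Suc i\<close>. The signs are opposite and the two words differ by a swap at place
  \<open>i\<close>, so each pair adds up to a signed \<open>swap_diff\<close>. The condition
  \<open>\<pi> i < \<pi> (Suc i)\<close> picks one member of each pair.\<close>

lemma alternating_eq_sum_swap_diff: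
  assumes i: "i \<in> descents w"
  shows "(alternating w :: 'a list \<Rightarrow>\<^sub>0 'f::field) =
    (\<Sum>\<pi> | \<pi> \<in> run_perms w \<and> \<pi> i < \<pi> (Suc i).
      scale (of_int (sign \<pi>)) (swap_diff i (permute_list \<pi> w)))"
proof -
  define \<tau> where "\<tau> = transpose i (Suc i)"
  define f :: "(nat \<Rightarrow> nat) \<Rightarrow> 'a list \<Rightarrow>\<^sub>0 'f"
    where "f \<pi> = Poly_Mapping.single (permute_list \<pi> w) (of_int (sign \<pi>))" for \<pi>
  let ?A = "{\<pi> \<in> run_perms w. \<pi> i < \<pi> (Suc i)}" and ?B = "{\<pi> \<in> run_perms w. \<pi> (Suc i) < \<pi> i}"
  have \<tau>: "\<tau> \<in> run_perms w" "\<tau> \<circ> \<tau> = id" "\<tau> i = Suc i" "\<tau> (Suc i) = i"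
    using transpose_in_run_perms[OF i] by (auto simp: \<tau>_def)
  have "\<pi> i \<noteq> \<pi> (Suc i)" if "\<pi> \<in> run_perms w" for \<pi>
    using that permutes_inj[of \<pi> "{..<length w}"] by (auto simp: run_perms_def dest: injD)
  then have "run_perms w = ?A \<union> ?B"
    using linorder_neqE_nat by blast
  then have "alternating w = sum f (?A \<union> ?B)"
    by (simp add: alternating_def f_def)
  also have "\<dots> = sum f ?A + sum f ?B"
    by (rule sum.union_disjoint) (auto simp: finite_run_perms)
  also have "sum f ?B = (\<Sum>\<pi>\<in>?A. f (\<pi> \<circ> \<tau>))"
    using \<tau> by (intro sum.reindex_bij_witness[of _ "\<lambda>\<pi>. \<pi> \<circ> \<tau>" "\<lambda>\<pi>. \<pi> \<circ> \<tau>"])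
      (auto simp: comp_assoc run_perms_comp)
  also have "sum f ?A + \<dots> = (\<Sum>\<pi>\<in>?A. f \<pi> + f (\<pi> \<circ> \<tau>))"
    by (simp add: sum.distrib)
  also have "\<dots> = (\<Sum>\<pi>\<in>?A. scale (of_int (sign \<pi>)) (swap_diff i (permute_list \<pi> w)))"
  proof (rule sum.cong)
    fix \<pi> assume "\<pi> \<in> ?A"
    then have "permutation \<pi>" "permutation \<tau>" "\<tau> permutes {..<length w}"
      using \<tau> by (auto simp: run_perms_def intro: permutes_imp_permutation)
    moreover from this have "sign (\<pi> \<circ> \<tau>) = - sign \<pi>"
      by (simp add: sign_compose) (simp add: \<tau>_def sign_swap_id)
    ultimately show "f \<pi> + f (\<pi> \<circ> \<tau>) = scale (of_int (sign \<pi>)) (swap_diff i (permute_list \<pi> w))"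
      by (simp add: f_def swap_diff_def FA.scale_right_diff_distrib permute_list_compose single_uminus
          flip: \<tau>_def)
  qed simp
  finally show ?thesis .
qed

text \<open>The chosen member of each pair puts the letter from later in the run, which is smaller,
  at place \<open>Suc i\<close>. So the decomposition of \<open>alternating w\<close> involves only
  swap differences at words that again have a descent at \<open>i\<close>.\<close>

lemma descents_permute_list:
  assumes \<pi>: "\<pi> \<in> run_perms w" and i: "i \<in> descents w" and "\<pi> i < \<pi> (Suc i)"
  shows "i \<in> descents (permute_list \<pi> w)"
proof -
  have "Suc i < length w"
    using i by (simp add: descents_def)
  moreover have "run_index w (\<pi> i) = run_index w (\<pi> (Suc i))"
    using \<pi> transpose_in_run_perms[OF i] by (auto simp: run_perms_def dest: spec[of _ i])
  then have "(w ! \<pi> (Suc i), w ! \<pi> i) \<in> r"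
    using run_perms_nth[OF \<pi>] \<open>Suc i < length w\<close> assms(3) by (intro less_if_run_index_eq) auto
  ultimately show ?thesis
    using run_perms_nth[OF \<pi>] by (simp add: descents_def)
qed

text \<open>The decomposition into pairs gives one inclusion. It is unitriangular: the identity
  contributes \<open>swap_diff i w\<close>, the other terms belong to lexicographically smaller
  words, and well-founded induction inverts it.\<close>

lemma span_swap_diff:
  "FA.span (swap_diff i ` {w \<in> words m. i \<in> descents w} :: ('a list \<Rightarrow>\<^sub>0 'f::field) set) =
    FA.span (alternating ` {w \<in> words m. i \<in> descents w})" (is "FA.span ?E = FA.span ?B")
proof
  have perm: "permute_list \<pi> w \<in> {w \<in> words m. i \<in> descents w}"
    if "w \<in> words m" "i \<in> descents w" "\<pi> \<in> run_perms w" "\<pi> i < \<pi> (Suc i)" for w \<pi>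
    using that descents_permute_list[of \<pi> w i] by (auto simp: words_def run_perms_def)
  have "alternating w \<in> FA.span ?E" if "w \<in> words m" "i \<in> descents w" for w
    unfolding alternating_eq_sum_swap_diff[OF that(2)]
    using perm[OF that] by (intro FA.span_sum FA.span_scale FA.span_base) auto
  then show "FA.span ?B \<subseteq> FA.span ?E"
    by (intro FA.span_minimal FA.subspace_span image_subsetI) blast
  have "w \<in> words m \<longrightarrow> i \<in> descents w \<longrightarrow> swap_diff i w \<in> FA.span ?B" for w
    using wf_lex[OF wf]
  proof (induction w rule: wf_induct_rule)
    case (less w)
    show ?case
    proof (intro impI)
      assume w: "w \<in> words m" "i \<in> descents w"
      let ?A = "{\<pi>. \<pi> \<in> run_perms w \<and> \<pi> i < \<pi> (Suc i)}"
      let ?f = "\<lambda>\<pi>. scale (of_int (sign \<pi>)) (swap_diff i (permute_list \<pi> w)) :: 'a list \<Rightarrow>\<^sub>0 'f"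
      \<comment> \<open>The identity is one of the chosen representatives because
        \<open>i < Suc i\<close>.\<close>
      have "alternating w = ?f id + sum ?f (?A - {id})"
        unfolding alternating_eq_sum_swap_diff[OF w(2)]
        by (rule sum.remove) (auto simp: finite_run_perms id_in_run_perms)
      then have "swap_diff i w = alternating w - sum ?f (?A - {id})"
        by simp
      also have "\<dots> \<in> FA.span ?B"
      proof (intro FA.span_diff FA.span_sum FA.span_scale)
        fix \<pi> assume "\<pi> \<in> ?A - {id}"
        then show "swap_diff i (permute_list \<pi> w) \<in> FA.span ?B"
          using less permute_list_less[of \<pi> w] perm[OF w, of \<pi>] by auto
      qed (use w in \<open>auto intro: FA.span_base\<close>)
      finally show "swap_diff i w \<in> FA.span ?B" .
    qed
  qed
  then show "FA.span ?E \<subseteq> FA.span ?B"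
    by (intro FA.span_minimal FA.subspace_span image_subsetI) blast
qed

theorem distributive:
  "generates_distributive_lattice (rel_subspaces X (FA.span commutators :: ('a list \<Rightarrow>\<^sub>0 'f::field) set) m)"
proof (rule FA.generates_distributive_lattice_if_independent)
  show "FA.independent (alternating ` words m)"
    by (rule independent_alternating)
next
  fix U :: "('a list \<Rightarrow>\<^sub>0 'f) set"
  assume "U \<in> rel_subspaces X (FA.span commutators) m"
  then obtain i where i: "1 \<le> i" "i \<le> m - 1" "U = rel_subspace X (FA.span commutators) (i - 1) (m - i - 1)"
    by (auto simp: rel_subspaces_def)
  \<comment> \<open>Subspaces are numbered from 1 but places of words from 0; the bounds on
    \<open>i\<close> make the truncated subtractions exact.\<close>
  moreover have "i - 1 + 2 + (m - i - 1) = m"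
    using i by simp
  ultimately have "U = FA.span (alternating ` {w \<in> words m. i - 1 \<in> descents w})"
    by (simp only: rel_subspace_commutators span_swap_diff)
  then show "\<exists>S \<subseteq> alternating ` words m. U = FA.span S"
    by (intro exI[of _ "alternating ` {w \<in> words m. i - 1 \<in> descents w}"] conjI image_mono Collect_restrict)
qed

end

section \<open>The algebra of a path\<close>

text \<open>Scaling is multiplication by a constant of the tensor algebra, so every ideal is a
  linear subspace, and the ideals containing \<open>S\<close> are those containing its span. This
  passes from a list of relations to the subspace that \<open>koszul\<close> asks for.\<close>

lemma presented_algebra_span:
  fixes S :: "('a list \<Rightarrow>\<^sub>0 'f::field) set"
  assumes "S \<subseteq> carrier (tensor_algebra X)"
  shows "presented_algebra X (FA.span S) = presented_algebra X S"
proof -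
  have "FA.span S \<subseteq> I" if "ideal I (tensor_algebra X)" "S \<subseteq> I" for I :: "('a list \<Rightarrow>\<^sub>0 'f) set"
  proof (rule FA.span_minimal)
    interpret ideal I "tensor_algebra X" by fact
    show "FA.subspace I"
    proof (rule FA.subspaceI)
      fix c :: 'f and f assume "f \<in> I"
      moreover have "Poly_Mapping.single 0 c \<in> carrier (tensor_algebra X)"
        by (simp add: tensor_algebra_def zero_list_def)
      ultimately show "scale c f \<in> I"
        using I_l_closed[of f "Poly_Mapping.single 0 c"] by (simp add: tensor_algebra_def scale_def)
    qed (use additive_subgroup.a_closed[OF additive_subgroup_axioms]
        additive_subgroup.zero_closed[OF additive_subgroup_axioms] in \<open>simp_all add: tensor_algebra_def\<close>)
  qed fact
  then have "{I. ideal I (tensor_algebra X) \<and> FA.span S \<subseteq> I} = {I. ideal I (tensor_algebra X) \<and> S \<subseteq> I}"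
    using FA.span_superset by blast
  then show ?thesis
    by (simp add: presented_algebra_def genideal_def)
qed

section \<open>The interval order on the generators\<close>

fun left_end :: "letter \<Rightarrow> nat"
  where "left_end (Vertex i) = i" | "left_end (Edge i j) = i"

fun right_end :: "letter \<Rightarrow> nat"
  where "right_end (Vertex i) = i" | "right_end (Edge i j) = j"

definition left_of :: "nat \<Rightarrow> letter rel"
  where "left_of n = {(x, y). x \<in> path_letters n \<and> y \<in> path_letters n \<and> right_end x < left_end y}"

lemma left_end_le_right_end: "x \<in> path_letters n \<Longrightarrow> left_end x \<le> right_end x"
  by (auto simp: path_letters_def)

interpretation path: transitive_commutation "path_letters n" "left_of n" for n
proof
  show "trans (left_of n)"
    using left_end_le_right_end by (fastforce simp: left_of_def intro!: transI)
  \<comment> \<open>Since \<open>left_end x \<le> right_end x\<close>, the left end strictly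
    increases along \<open>left_of n\<close>.\<close>
  have "left_of n \<subseteq> measure left_end"
    using left_end_le_right_end by (fastforce simp: left_of_def)
  then show "wf (left_of n)"
    by (rule wf_subset[OF wf_measure])
qed (auto simp: left_of_def)

section \<open>The presentation and the interval commutators\<close>

text \<open>Equality of letters is allowed because the presentation also lists the trivial relations
  \<open>[v_i, v_i] = 0\<close>; the two orientations differ by a sign.\<close>

lemma commutator_letters_in_span:
  assumes "x = y \<or> (x, y) \<in> left_of n \<or> (y, x) \<in> left_of n"
  shows "commutator (Poly_Mapping.single [x] 1) (Poly_Mapping.single [y] (1::'f::field)) \<in>
    FA.span (path.commutators n)"
proof -
  have *: "Poly_Mapping.single [x, y] 1 - Poly_Mapping.single [y, x] (1::'f) \<in> FA.span (path.commutators n)"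
    if "(y, x) \<in> left_of n" for x y
    using that by (intro FA.span_base) (auto simp: path.commutators_def)
  show ?thesis
    using assms *[of y x] FA.span_neg[OF *[of x y]] by (auto simp: commutator_def FA.span_zero)
qed

lemma commutator_swap: "commutator x y = - commutator y x"
  by (simp add: commutator_def)

lemma commutator_left_of_in_span:
  assumes "(y, x) \<in> left_of n"
  shows "commutator (Poly_Mapping.single [x] 1) (Poly_Mapping.single [y] (1::'f::field)) \<in>
    FA.span (path_relations n)"
proof -
  let ?R = "path_relations n :: (letter list \<Rightarrow>\<^sub>0 'f) set"
  have *: "commutator f g \<in> FA.span ?R" if "commutator f g \<in> ?R \<or> commutator g f \<in> ?R" for f g
    using that FA.span_neg[of "commutator g f" ?R] FA.span_base[of _ ?R]
    by (auto simp: commutator_swap[of f g])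
  have ve: "commutator (vgen i) (egen j (j + 1)) \<in> ?R"
    if "i \<in> {1..n}" "j \<in> {1..n - 1}" "i < j \<or> j + 1 < i" for i j
  proof -
    \<comment> \<open>A vertex misses an edge when it lies just before it, just after it, or farther
      away; the presentation lists these three cases separately.\<close>
    consider "j = i + 1" | "i = j + 2" | "j > i + 1 \<or> j + 2 < i"
      using \<open>i < j \<or> j + 1 < i\<close> by linarith
    then show ?thesis
    proof cases
      case 1
      then have "i \<in> {1..n - 2}"
        using that by auto
      then have "commutator (vgen i) (egen (i + 1) (i + 2)) \<in> ?R"
        unfolding path_relations_def by blast
      then show ?thesis
        using 1 by simp
    next
      case 2
      then have "j \<in> {1..n - 2}"
        using that by auto
      then have "commutator (vgen (j + 2)) (egen j (j + 1)) \<in> ?R"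
        unfolding path_relations_def by blast
      then show ?thesis
        using 2 by simp
    next
      case 3
      then show ?thesis
        using that unfolding path_relations_def by blast
    qed
  qed
  have vv: "commutator (vgen i) (vgen j) \<in> ?R" if "i \<in> {1..n}" "j \<in> {1..n}" for i j
    using that unfolding path_relations_def by blast
  have ee: "commutator (egen i (i + 1)) (egen j (j + 1)) \<in> ?R"
    if "i \<in> {1..n - 1}" "j \<in> {1..n - 1}" "j > i + 1" for i j
    using that unfolding path_relations_def by blast
  show ?thesis
    using assms vv ve ee
    by (intro *) (auto simp: left_of_def path_letters_def vgen_def egen_def)
qed

text \<open>The defining relations may be zero or carry the opposite sign, so the two sets are
  compared through their spans.\<close>

lemma span_path_relations:
  "FA.span (path_relations n) = FA.span (path.commutators n :: (letter list \<Rightarrow>\<^sub>0 'f::field) set)"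
proof (rule antisym)
  show "FA.span (path_relations n) \<subseteq> FA.span (path.commutators n :: (letter list \<Rightarrow>\<^sub>0 'f) set)"
  proof (intro FA.span_minimal FA.subspace_span subsetI)
    fix f :: "letter list \<Rightarrow>\<^sub>0 'f"
    assume "f \<in> path_relations n"
    then show "f \<in> FA.span (path.commutators n)"
      unfolding path_relations_def vgen_def egen_def
      by (elim UnE CollectE exE conjE; hypsubst, intro commutator_letters_in_span)
        (auto simp: left_of_def path_letters_def)
  qed
  show "FA.span (path.commutators n :: (letter list \<Rightarrow>\<^sub>0 'f) set) \<subseteq> FA.span (path_relations n)"
  proof (intro FA.span_minimal FA.subspace_span subsetI)
    fix f :: "letter list \<Rightarrow>\<^sub>0 'f"
    assume "f \<in> path.commutators n"
    then obtain x y where "(y, x) \<in> left_of n"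
      "f = Poly_Mapping.single [x, y] 1 - Poly_Mapping.single [y, x] 1"
      by (auto simp: path.commutators_def)
    then show "f \<in> FA.span (path_relations n)"
      using commutator_left_of_in_span[of y x n, where 'f = 'f] by (simp add: commutator_def)
  qed
qed

lemma path_relations_subset:
  "path_relations n \<subseteq> (tensor_power (path_letters n) 2 :: (letter list \<Rightarrow>\<^sub>0 'f::field) set)"
proof -
  have "FA.span (path.commutators n) \<subseteq> (tensor_power (path_letters n) 2 :: (letter list \<Rightarrow>\<^sub>0 'f) set)"
  proof (rule FA.span_minimal[OF _ subspace_tensor_power], rule subsetI)
    fix f :: "letter list \<Rightarrow>\<^sub>0 'f"
    assume "f \<in> path.commutators n"
    then obtain x y where "x \<in> path_letters n" "y \<in> path_letters n"
      "f = Poly_Mapping.single [x, y] 1 - Poly_Mapping.single [y, x] 1"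
      using path.letters by (auto simp: path.commutators_def)
    then show "f \<in> tensor_power (path_letters n) 2"
      using keys_diff[of "Poly_Mapping.single [x, y] (1::'f)" "Poly_Mapping.single [y, x] 1"]
      by (auto simp: tensor_power_def)
  qed
  then show ?thesis
    using FA.span_superset[of "path_relations n"] by (simp add: span_path_relations) blast
qed

theorem mainTheorem2:
  fixes n :: nat
  assumes "n \<ge> 1"
  shows "koszul (ch_path n :: ('f::field, (letter list \<Rightarrow>\<^sub>0 'f) set) module)"
proof -
  have "FA.span (path_relations n) \<subseteq> (tensor_power (path_letters n) 2 :: (letter list \<Rightarrow>\<^sub>0 'f) set)"
    by (rule FA.span_minimal[OF path_relations_subset subspace_tensor_power])
  moreover have "ch_path n =
      presented_algebra (path_letters n) (FA.span (path_relations n) :: (letter list \<Rightarrow>\<^sub>0 'f) set)"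
    using path_relations_subset[of n, where 'f = 'f] unfolding ch_path_def
    by (intro presented_algebra_span[symmetric]) (auto simp: tensor_power_def tensor_algebra_def)
  ultimately show ?thesis
    unfolding koszul_def
    \<comment> \<open>The witness for \<open>R\<close> is the span of the defining relations, to
      which the distributivity result applies after rewriting it as the span of the interval
      commutators.\<close>
    by (intro exI[of _ "path_letters n"] exI[of _ "FA.span (path_relations n)"])
      (simp add: span_path_relations path.distributive)
qed

end
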